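(* Let $G=(V,E)$ be a finite simple graph. (i) The dimension of the vector space $\mathbb{VD}(Z_G)$ is the number of non-empty subsets $K\subseteq V$ inducing a clique of $G$ (single vertices are counted). (ii) The faces $\triangle_K=\operatorname{conv}\{\mathbf{e}_u : u\in K\}$ of the standard simplex $\triangle_V$, for all non-empty $K\subseteq V$ inducing a clique of $G$, form a linear basis of $\mathbb{VD}(Z_G)$. (iii) For each $S\subseteq V$ with $|S|\ge 2$ not inducing a clique of $G$, choose one pair $\{u_S,v_S\}\in\binom{S}{2}\smallsetminus E$. Then $\mathbb{VD}(Z_G)$ is the set of virtual polytopes $D_h$ for all $h\in\mathbb{R}^{2^V}$ satisfying the equations $$h_{\varnothing}=-h_V,$$ $$h_{S\smallsetminus\{u_S\}}+h_{S\smallsetminus\{v_S\}}=h_S+h_{S\smallsetminus\{u_S,v_S\}}\quad\text{for each } S\subseteq V \text{ with } |S|\ge 2 \text{ not inducing a clique of } G,$$ and these equations are linearly independent.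
   Context: $G=(V,E)$ is a finite simple graph, so $E\subseteq\binom{V}{2}$, where $\binom{X}{2}$ denotes the set of two-element subsets of $X$. A subset $S\subseteq V$ induces a clique if all pairs of distinct elements of $S$ are edges. $(\mathbf{e}_v)_{v\in V}$ is the canonical basis of $\mathbb{R}^V$, and $2^V$ is the set of all subsets of $V$. The graphical zonotope is the Minkowski sum $Z_G=\sum_{\{u,v\}\in E}[\mathbf{e}_u,\mathbf{e}_v]\subset\mathbb{R}^V$. A (nonempty) polytope $P\subset\mathbb{R}^V$ is a weak Minkowski summand, or deformation, of a polytope $R\subset\mathbb{R}^V$ if there are $\lambda\ge 0$ and a polytope $Q$ with $P+Q=\lambda R$. The deformation cone $\mathbb{DC}(R)$ is the set of all deformations of $R$. Virtual polytopes: the real vector space of virtual polytopes in $\mathbb{R}^V$ consists of formal differences $P-Q$ of polytopes modulo $(P_1-Q_1)=(P_2-Q_2)$ whenever $P_1+P_2'=P_2+P_1'$ with $P_i'=Q_i$ (i.e. $P_1+Q_2=P_2+Q_1$), with addition induced by Minkowski addition and scalar multiplication $\lambda(P-Q)=\lambda P-\lambda Q$ for $\lambda\ge 0$ and $\lambda(P-Q)=(-\lambda)Q-(-\lambda)P$ for $\lambda<0$. A polytope $P$ is identified with $P-\{0\}$. The space of virtual deformations $\mathbb{VD}(Z_G)$ is the linear span of $\mathbb{DC}(Z_G)$ in this vector space. For $h\in\mathbb{R}^{2^V}$, the polyhedron $D_h=\{x\in\mathbb{R}^V : \sum_{v\in S}x_v-\sum_{v\notin S}x_v\le h_S \text{ for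 all } S\subseteq V\}$. Every deformation $P$ of $Z_G$ is $P=D_{h^P}$ with $h^P_S=\max_{x\in P}\big(\sum_{v\in S}x_v-\sum_{v\notin S}x_v\big)$. For virtual deformations the notation is extended as follows: for $P,Q\in\mathbb{DC}(Z_G)$, the virtual polytope $P-Q$ is denoted $D_{h}$ with $h=h^P-h^Q$; the vector $h$ determines the equivalence class of $P-Q$. *)

theory Defs
  imports "HOL-Analysis.Analysis"
begin

section \<open>Virtual polytopes\<close>

definition nonempty_polytope :: "'a::euclidean_space set \<Rightarrow> bool" where
  "nonempty_polytope P \<longleftrightarrow> polytope P \<and> P \<noteq> {}"

text \<open>
  A pair \<open>(P, Q)\<close> stands for the formal difference \<open>P - Q\<close>. Minkowski addition is the
  addition on sets of \<open>HOL-Library.Set_Algebras\<close>. The relation is reflexive only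
  on pairs of nonempty polytopes, so the quotient below is a partial one.
\<close>

definition virtual_rel :: "'a::euclidean_space set \<times> 'a set \<Rightarrow> 'a set \<times> 'a set \<Rightarrow> bool" where
  "virtual_rel = (\<lambda>(P1, Q1) (P2, Q2).
     nonempty_polytope P1 \<and> nonempty_polytope Q1 \<and>
     nonempty_polytope P2 \<and> nonempty_polytope Q2 \<and>
     P1 + Q2 = P2 + Q1)"

text \<open>
  The support function is used only to establish the quotient and the vector space axioms:
  on virtual polytopes, \<open>P - Q\<close> corresponds to the difference of the support functions.
\<close>

definition support_fun :: "'a::euclidean_space set \<Rightarrow> 'a \<Rightarrow> real" where
  "support_fun P u = (SUP x\<in>P. u \<bullet> x)"

lemma nonempty_polytope_plus:
  "nonempty_polytope P \<Longrightarrow> nonempty_polytope Q \<Longrightarrow> nonempty_polytope (P + Q)"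
  unfolding nonempty_polytope_def polytope_def
  by (metis convex_hull_set_plus finite_set_plus set_plus_intro equals0I ex_in_conv)

lemma nonempty_polytope_scaleR:
  "nonempty_polytope P \<Longrightarrow> nonempty_polytope ((*\<^sub>R) c ` P)"
  using polytope_scaling[of P c] by (auto simp: nonempty_polytope_def)

lemma nonempty_polytope_sing: "nonempty_polytope {a}"
  by (simp add: nonempty_polytope_def polytope_sing)

lemma support_fun_attained:
  assumes "nonempty_polytope P"
  obtains x where "x \<in> P" "support_fun P u = u \<bullet> x" "\<And>y. y \<in> P \<Longrightarrow> u \<bullet> y \<le> u \<bullet> x"
proof -
  have "compact P" "P \<noteq> {}"
    using assms by (auto simp: nonempty_polytope_def polytope_imp_compact)
  moreover have "continuous_on P (\<lambda>x. u \<bullet> x)"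
    by (intro continuous_intros)
  ultimately obtain x where x: "x \<in> P" "\<And>y. y \<in> P \<Longrightarrow> u \<bullet> y \<le> u \<bullet> x"
    using continuous_attains_sup[of P "\<lambda>x. u \<bullet> x"] by blast
  have "support_fun P u = u \<bullet> x"
    unfolding support_fun_def using x by (intro cSup_eq_maximum) auto
  with x that show thesis by blast
qed

lemma support_fun_plus:
  assumes "nonempty_polytope P" "nonempty_polytope Q"
  shows "support_fun (P + Q) u = support_fun P u + support_fun Q u"
proof -
  obtain x where x: "x \<in> P" "support_fun P u = u \<bullet> x" "\<And>y. y \<in> P \<Longrightarrow> u \<bullet> y \<le> u \<bullet> x"
    using support_fun_attained[OF assms(1)] by metis
  obtain y where y: "y \<in> Q" "support_fun Q u = u \<bullet> y" "\<And>z. z \<in> Q \<Longrightarrow> u \<bullet> z \<le> u \<bullet> y"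
    using support_fun_attained[OF assms(2)] by metis
  have "support_fun (P + Q) u = u \<bullet> (x + y)"
    unfolding support_fun_def
  proof (intro cSup_eq_maximum)
    show "u \<bullet> (x + y) \<in> (\<bullet>) u ` (P + Q)"
      using x(1) y(1) by blast
    show "z \<le> u \<bullet> (x + y)" if "z \<in> (\<bullet>) u ` (P + Q)" for z
      using that x(3) y(3) by (auto simp: set_plus_def inner_add_right add_mono)
  qed
  with x y show ?thesis by (simp add: inner_add_right)
qed

lemma support_fun_scaleR:
  assumes "nonempty_polytope P" "0 \<le> c"
  shows "support_fun ((*\<^sub>R) c ` P) u = c * support_fun P u"
proof -
  obtain x where x: "x \<in> P" "support_fun P u = u \<bullet> x" "\<And>y. y \<in> P \<Longrightarrow> u \<bullet> y \<le> u \<bullet> x"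
    using support_fun_attained[OF assms(1)] by metis
  have "support_fun ((*\<^sub>R) c ` P) u = c * (u \<bullet> x)"
    unfolding support_fun_def
    using x assms(2) by (intro cSup_eq_maximum) (auto simp: image_iff mult_left_mono)
  with x show ?thesis by simp
qed

lemma support_fun_sing [simp]: "support_fun {a} u = u \<bullet> a"
  by (simp add: support_fun_def)

lemma support_fun_le_imp_subset:
  assumes "nonempty_polytope P" "nonempty_polytope Q" "\<And>u. support_fun P u \<le> support_fun Q u"
  shows "P \<subseteq> Q"
proof
  fix z assume "z \<in> P"
  show "z \<in> Q"
  proof (rule ccontr)
    assume "z \<notin> Q"
    moreover have "convex Q" "closed Q"
      using assms(2) by (auto simp: nonempty_polytope_def polytope_imp_convex polytope_imp_closed)
    ultimately obtain a b where ab: "a \<bullet> z < b" "\<forall>x\<in>Q. a \<bullet> x > b"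
      using separating_hyperplane_closed_point by metis
    obtain x where x: "x \<in> P" "support_fun P (-a) = (-a) \<bullet> x" "\<And>y. y \<in> P \<Longrightarrow> (-a) \<bullet> y \<le> (-a) \<bullet> x"
      using support_fun_attained[OF assms(1)] by metis
    obtain y where y: "y \<in> Q" "support_fun Q (-a) = (-a) \<bullet> y"
      using support_fun_attained[OF assms(2)] by metis
    show False
      using assms(3)[of "-a"] x y ab \<open>z \<in> P\<close> by fastforce
  qed
qed

lemma support_fun_eq_iff:
  assumes "nonempty_polytope P" "nonempty_polytope Q"
  shows "P = Q \<longleftrightarrow> support_fun P = support_fun Q"
  using support_fun_le_imp_subset[OF assms] support_fun_le_imp_subset[OF assms(2,1)]
  by (metis order_refl subset_antisym)

lemma virtual_rel_iff:
  "virtual_rel (P1, Q1) (P2, Q2) \<longleftrightarrow>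
     nonempty_polytope P1 \<and> nonempty_polytope Q1 \<and>
     nonempty_polytope P2 \<and> nonempty_polytope Q2 \<and>
     (\<forall>u. support_fun P1 u - support_fun Q1 u = support_fun P2 u - support_fun Q2 u)"
proof (cases "nonempty_polytope P1 \<and> nonempty_polytope Q1 \<and>
     nonempty_polytope P2 \<and> nonempty_polytope Q2")
  case True
  then have "P1 + Q2 = P2 + Q1 \<longleftrightarrow> support_fun (P1 + Q2) = support_fun (P2 + Q1)"
    by (intro support_fun_eq_iff nonempty_polytope_plus) auto
  also have "\<dots> \<longleftrightarrow>
      (\<forall>u. support_fun P1 u + support_fun Q2 u = support_fun P2 u + support_fun Q1 u)"
    using True by (simp add: fun_eq_iff support_fun_plus)
  also have "\<dots> \<longleftrightarrow>
      (\<forall>u. support_fun P1 u - support_fun Q1 u = support_fun P2 u - support_fun Q2 u)"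
    by (intro all_cong1) linarith
  finally show ?thesis using True by (simp add: virtual_rel_def)
qed (auto simp: virtual_rel_def)

lemma virtual_rel_swap:
  assumes "virtual_rel (P1, Q1) (P2, Q2)"
  shows "virtual_rel (Q1, P1) (Q2, P2)"
  using assms by (auto simp: virtual_rel_def add.commute)

lemma virtual_rel_scaleR:
  assumes "virtual_rel (P1, Q1) (P2, Q2)" "0 \<le> c"
  shows "virtual_rel ((*\<^sub>R) c ` P1, (*\<^sub>R) c ` Q1) ((*\<^sub>R) c ` P2, (*\<^sub>R) c ` Q2)"
  using assms
  by (simp add: virtual_rel_iff nonempty_polytope_scaleR support_fun_scaleR
      flip: right_diff_distrib)

lemma part_equivp_virtual_rel: "part_equivp virtual_rel"
proof (rule part_equivpI)
  show "\<exists>x. virtual_rel x (x :: 'a set \<times> 'a set)"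
    by (rule exI[of _ "({0}, {0})"]) (simp add: virtual_rel_iff nonempty_polytope_sing)
  show "symp (virtual_rel :: 'a set \<times> 'a set \<Rightarrow> _)"
    by (rule sympI) (auto simp: virtual_rel_iff)
  show "transp (virtual_rel :: 'a set \<times> 'a set \<Rightarrow> _)"
  proof (rule transpI)
    fix x y z :: "'a set \<times> 'a set"
    assume xy: "virtual_rel x y" and yz: "virtual_rel y z"
    obtain P1 Q1 P2 Q2 P3 Q3 where [simp]: "x = (P1, Q1)" "y = (P2, Q2)" "z = (P3, Q3)"
      by (metis surj_pair)
    with xy yz show "virtual_rel x z"
      by (simp add: virtual_rel_iff)
  qed
qed

quotient_type (overloaded) 'a virtual_polytope =
  "'a::euclidean_space set \<times> 'a set" / partial: virtual_rel
  by (rule part_equivp_virtual_rel)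

instantiation virtual_polytope :: (euclidean_space) real_vector
begin

lift_definition zero_virtual_polytope :: "'a virtual_polytope" is "({0}, {0})"
  by (simp add: virtual_rel_iff nonempty_polytope_sing)

lift_definition plus_virtual_polytope ::
    "'a virtual_polytope \<Rightarrow> 'a virtual_polytope \<Rightarrow> 'a virtual_polytope"
  is "\<lambda>(P1, Q1) (P2, Q2). (P1 + P2, Q1 + Q2)"
  by (auto simp: virtual_rel_iff nonempty_polytope_plus support_fun_plus add_diff_add)

lift_definition uminus_virtual_polytope :: "'a virtual_polytope \<Rightarrow> 'a virtual_polytope"
  is "\<lambda>(P, Q). (Q, P)"
  by (auto intro: virtual_rel_swap)

definition minus_virtual_polytope ::
    "'a virtual_polytope \<Rightarrow> 'a virtual_polytope \<Rightarrow> 'a virtual_polytope" where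
  "minus_virtual_polytope X Y = X + - Y"

lift_definition scaleR_virtual_polytope :: "real \<Rightarrow> 'a virtual_polytope \<Rightarrow> 'a virtual_polytope"
  is "\<lambda>c (P, Q). if 0 \<le> c then ((*\<^sub>R) c ` P, (*\<^sub>R) c ` Q)
                 else ((*\<^sub>R) (- c) ` Q, (*\<^sub>R) (- c) ` P)"
  by (auto intro!: virtual_rel_scaleR intro: virtual_rel_swap simp del: scaleR_minus_left)

lift_definition virtual_support :: "'a virtual_polytope \<Rightarrow> 'a \<Rightarrow> real"
  is "\<lambda>(P, Q) u. support_fun P u - support_fun Q u"
  by (auto simp: virtual_rel_iff fun_eq_iff)

lemma virtual_eqI: "X = Y" if "\<And>u. virtual_support X u = virtual_support Y u"
  for X Y :: "'a virtual_polytope"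
  using that by transfer (auto simp: virtual_rel_iff)

lemma virtual_support_zero: "virtual_support 0 u = 0"
  by transfer simp

lemma virtual_support_plus:
  "virtual_support (X + Y) u = virtual_support X u + virtual_support Y u"
  by transfer (auto simp: virtual_rel_iff support_fun_plus)

lemma virtual_support_uminus: "virtual_support (- X) u = - virtual_support X u"
  by transfer auto

lemma virtual_support_scaleR: "virtual_support (c *\<^sub>R X) u = c * virtual_support X u"
proof (transfer fixing: c u, clarify)
  fix P Q :: "'a set"
  assume "virtual_rel (P, Q) (P, Q)"
  then have P: "nonempty_polytope P" and Q: "nonempty_polytope Q"
    by (auto simp: virtual_rel_def)
  show "(case (if 0 \<le> c then ((*\<^sub>R) c ` P, (*\<^sub>R) c ` Q)
               else ((*\<^sub>R) (- c) ` Q, (*\<^sub>R) (- c) ` P)) of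
           (P, Q) \<Rightarrow> \<lambda>u. support_fun P u - support_fun Q u) u
        = c * (support_fun P u - support_fun Q u)"
  proof (cases "0 \<le> c")
    case True
    then show ?thesis
      using P Q by (simp add: support_fun_scaleR algebra_simps)
  next
    case False
    then show ?thesis
      using support_fun_scaleR[OF P, of "- c" u] support_fun_scaleR[OF Q, of "- c" u]
      by (simp add: algebra_simps del: scaleR_minus_left)
  qed
qed

instance
  by standard
    (auto intro!: virtual_eqI simp: virtual_support_zero virtual_support_plus
      virtual_support_uminus virtual_support_scaleR minus_virtual_polytope_def algebra_simps)

end

text \<open>The class of \<open>P - Q\<close>, meaningful for nonempty polytopes \<open>P\<close> and \<open>Q\<close> only.\<close>

definition virtual_diff :: "'a::euclidean_space set \<Rightarrow> 'a set \<Rightarrow> 'a virtual_polytope" where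
  "virtual_diff P Q = abs_virtual_polytope (P, Q)"

abbreviation virtual_of :: "'a::euclidean_space set \<Rightarrow> 'a virtual_polytope" where
  "virtual_of P \<equiv> virtual_diff P {0}"

lemma virtual_diff_eq_iff:
  assumes "nonempty_polytope P1" "nonempty_polytope Q1"
    and "nonempty_polytope P2" "nonempty_polytope Q2"
  shows "virtual_diff P1 Q1 = virtual_diff P2 Q2 \<longleftrightarrow> P1 + Q2 = P2 + Q1"
proof -
  have "virtual_rel (P1, Q1) (P1, Q1)" "virtual_rel (P2, Q2) (P2, Q2)"
    using assms by (auto simp: virtual_rel_def)
  then show ?thesis
    using Quotient_rel[OF Quotient_virtual_polytope, of "(P1, Q1)" "(P2, Q2)"] assms
    by (auto simp: virtual_diff_def virtual_rel_def)
qed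

lemma virtual_diff_eq_minus:
  assumes "nonempty_polytope P" "nonempty_polytope Q"
  shows "virtual_diff P Q = virtual_of P - virtual_of Q"
  using assms unfolding virtual_diff_def minus_virtual_polytope_def
  by (simp add: uminus_virtual_polytope.abs_eq plus_virtual_polytope.abs_eq
      virtual_rel_def nonempty_polytope_sing eq_onp_def)


section \<open>Deformations\<close>

definition deformation_cone :: "'a::euclidean_space set \<Rightarrow> 'a set set" where
  "deformation_cone R = {P. nonempty_polytope P \<and>
     (\<exists>c\<ge>0. \<exists>Q. nonempty_polytope Q \<and> P + Q = (*\<^sub>R) c ` R)}"

definition virtual_deformations :: "'a::euclidean_space set \<Rightarrow> 'a virtual_polytope set" where
  "virtual_deformations R = span (virtual_of ` deformation_cone R)"


section \<open>Graphical zonotopes\<close>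

text \<open>
  The vertex set is the finite type \<open>'v\<close> and a graph on it is its set of edges, each a set of two
  vertices. Vectors indexed by \<open>2\<^sup>V\<close> have type \<open>real ^ ('v set)\<close>.
\<close>

definition simple_graph :: "'v set set \<Rightarrow> bool" where
  "simple_graph E \<longleftrightarrow> (\<forall>e\<in>E. card e = 2)"

definition induces_clique :: "'v set set \<Rightarrow> 'v set \<Rightarrow> bool" where
  "induces_clique E S \<longleftrightarrow> (\<forall>u\<in>S. \<forall>v\<in>S. u \<noteq> v \<longrightarrow> {u, v} \<in> E)"

definition nonempty_cliques :: "'v set set \<Rightarrow> 'v set set" where
  "nonempty_cliques E = {K. K \<noteq> {} \<and> induces_clique E K}"

definition nonclique_sets :: "'v set set \<Rightarrow> 'v set set" where
  "nonclique_sets E = {S. card S \<ge> 2 \<and> \<not> induces_clique E S}"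

text \<open>\<open>simplex_face {u, v}\<close> is the segment from \<open>e_u\<close> to \<open>e_v\<close>.\<close>

definition simplex_face :: "'v::finite set \<Rightarrow> (real ^ 'v) set" where
  "simplex_face K = convex hull ((\<lambda>u. axis u 1) ` K)"

lemma simplex_face_pair: "simplex_face {u, v} = closed_segment (axis u 1) (axis v 1)"
  by (simp add: simplex_face_def segment_convex_hull)

definition graphical_zonotope :: "'v::finite set set \<Rightarrow> (real ^ 'v) set" where
  "graphical_zonotope E = (\<Sum>e\<in>E. simplex_face e)"

text \<open>The supremum is a maximum whenever \<open>P\<close> is a nonempty polytope.\<close>

definition height_vector :: "(real ^ 'v::finite) set \<Rightarrow> real ^ ('v set)" where
  "height_vector P = (\<chi> S. SUP x\<in>P. (\<Sum>v\<in>S. x $ v) - (\<Sum>v\<in>- S. x $ v))"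

lemma height_vector_attained:
  assumes "nonempty_polytope P"
  obtains x where "x \<in> P" "height_vector P $ S = (\<Sum>v\<in>S. x $ v) - (\<Sum>v\<in>- S. x $ v)"
    and "\<And>y. y \<in> P \<Longrightarrow> (\<Sum>v\<in>S. y $ v) - (\<Sum>v\<in>- S. y $ v) \<le> height_vector P $ S"
proof -
  have "compact P" "P \<noteq> {}"
    using assms by (auto simp: nonempty_polytope_def polytope_imp_compact)
  moreover have "continuous_on P (\<lambda>x. (\<Sum>v\<in>S. x $ v) - (\<Sum>v\<in>- S. x $ v))"
    by (intro continuous_intros)
  ultimately obtain x where x: "x \<in> P"
    "\<And>y. y \<in> P \<Longrightarrow> (\<Sum>v\<in>S. y $ v) - (\<Sum>v\<in>- S. y $ v) \<le> (\<Sum>v\<in>S. x $ v) - (\<Sum>v\<in>- S. x $ v)"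
    using continuous_attains_sup by meson
  have "height_vector P $ S = (\<Sum>v\<in>S. x $ v) - (\<Sum>v\<in>- S. x $ v)"
    unfolding height_vector_def vec_lambda_beta using x by (intro cSup_eq_maximum) auto
  with x that show thesis by metis
qed

text \<open>
  \<open>represents E h X\<close>: the virtual polytope \<open>X\<close> is a difference \<open>P - Q\<close> of deformations of the
  zonotope whose height vectors differ by \<open>h\<close>. The notation \<open>D_h\<close> is available
  exactly for those \<open>h\<close> that represent some \<open>X\<close>.
\<close>

definition represents ::
    "'v::finite set set \<Rightarrow> real ^ ('v set) \<Rightarrow> (real ^ 'v) virtual_polytope \<Rightarrow> bool" where
  "represents E h X \<longleftrightarrow>
     (\<exists>P\<in>deformation_cone (graphical_zonotope E). \<exists>Q\<in>deformation_cone (graphical_zonotope E).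
        h = height_vector P - height_vector Q \<and> X = virtual_diff P Q)"

definition virtual_D ::
    "'v::finite set set \<Rightarrow> real ^ ('v set) \<Rightarrow> (real ^ 'v) virtual_polytope" where
  "virtual_D E h = (THE X. represents E h X)"

definition nonedge_choice :: "'v set set \<Rightarrow> ('v set \<Rightarrow> 'v) \<Rightarrow> ('v set \<Rightarrow> 'v) \<Rightarrow> bool" where
  "nonedge_choice E us vs \<longleftrightarrow>
     (\<forall>S\<in>nonclique_sets E. us S \<in> S \<and> vs S \<in> S \<and> us S \<noteq> vs S \<and> {us S, vs S} \<notin> E)"

text \<open>
  The coefficient vectors of the equations: \<open>None\<close> for the equation between the empty set and the
  whole vertex set, \<open>Some S\<close> for the one belonging to \<open>S\<close>.
\<close>

fun equation_coeffs ::
    "('v::finite set \<Rightarrow> 'v) \<Rightarrow> ('v set \<Rightarrow> 'v) \<Rightarrow> 'v set option \<Rightarrow> real ^ ('v set)" where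
  "equation_coeffs us vs None = axis {} 1 + axis UNIV 1"
| "equation_coeffs us vs (Some S) =
     axis (S - {us S}) 1 + axis (S - {vs S}) 1 - axis S 1 - axis (S - {us S, vs S}) 1"

lemma equation_coeffs_None_iff:
  "equation_coeffs us vs None \<bullet> h = 0 \<longleftrightarrow> h $ {} = - (h $ UNIV)"
  by (simp add: inner_add_left inner_axis' eq_neg_iff_add_eq_0)

lemma equation_coeffs_Some_iff:
  "equation_coeffs us vs (Some S) \<bullet> h = 0 \<longleftrightarrow>
     h $ (S - {us S}) + h $ (S - {vs S}) = h $ S + h $ (S - {us S, vs S})"
  by (auto simp: inner_add_left inner_diff_left inner_axis')

end

theory Submission
  imports Defs
begin

text \<open>
  Along pairs of directions that no edge orders oppositely, support functions of deformations are
  additive. Hence a virtual deformation is determined by its height vector, and this vector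
  satisfies the equations. The equations are linearly independent, so their solution space has
  dimension the number of nonempty cliques, which is also the number of faces \<open>\<triangle>\<^sub>K\<close>. These faces
  are deformations because, for a clique \<open>K\<close>, the permutahedron of \<open>K\<close> is a translate of the sum of
  the hypersimplices of \<open>K\<close>, the first of which is \<open>\<triangle>\<^sub>K\<close>; and their height vectors are linearly
  independent. So they form a basis and every solution is the height vector of exactly one virtual
  deformation.
\<close>

section \<open>Support functions of sums and convex hulls\<close>

lemma virtual_rel_refl_iff:
  "virtual_rel (P, Q) (P, Q) \<longleftrightarrow> nonempty_polytope P \<and> nonempty_polytope Q"
  by (auto simp: virtual_rel_iff)

lemma virtual_support_diff:
  assumes "nonempty_polytope P" "nonempty_polytope Q"
  shows "virtual_support (virtual_diff P Q) u = support_fun P u - support_fun Q u"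
  using assms by (simp add: virtual_diff_def virtual_support.abs_eq virtual_rel_refl_iff)

lemma virtual_support_of:
  "nonempty_polytope P \<Longrightarrow> virtual_support (virtual_of P) u = support_fun P u"
  by (simp add: virtual_support_diff nonempty_polytope_sing)

lemma support_fun_ge:
  assumes "nonempty_polytope P" "x \<in> P"
  shows "u \<bullet> x \<le> support_fun P u"
  using support_fun_attained[OF assms(1), of u] assms(2) by metis

lemma support_fun_subadditive:
  assumes "nonempty_polytope P"
  shows "support_fun P (u + w) \<le> support_fun P u + support_fun P w"
proof -
  obtain x where "x \<in> P" "support_fun P (u + w) = (u + w) \<bullet> x"
    using support_fun_attained[OF assms] by metis
  with support_fun_ge[OF assms, of x] show ?thesis
    by (simp add: inner_add_left add_mono)
qed

lemma support_fun_pos_homogeneous: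
  assumes "nonempty_polytope P" "0 \<le> c"
  shows "support_fun P (c *\<^sub>R u) = c * support_fun P u"
proof -
  obtain x where "x \<in> P" "support_fun P u = u \<bullet> x"
    using support_fun_attained[OF assms(1)] by metis
  then have "c * support_fun P u \<le> support_fun P (c *\<^sub>R u)"
    using support_fun_ge[OF assms(1), of x "c *\<^sub>R u"] by simp
  moreover obtain y where "y \<in> P" "support_fun P (c *\<^sub>R u) = (c *\<^sub>R u) \<bullet> y"
    using support_fun_attained[OF assms(1)] by metis
  then have "support_fun P (c *\<^sub>R u) \<le> c * support_fun P u"
    using support_fun_ge[OF assms(1), of y u] assms(2) by (simp add: mult_left_mono)
  ultimately show ?thesis by simp
qed

lemma nonempty_polytope_sum:
  assumes "finite I" "\<And>i. i \<in> I \<Longrightarrow> nonempty_polytope (P i)"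
  shows "nonempty_polytope (\<Sum>i\<in>I. P i)"
  using assms
  by (induction I rule: finite_induct)
    (auto intro: nonempty_polytope_plus simp: nonempty_polytope_sing)

lemma support_fun_sum:
  assumes "finite I" "\<And>i. i \<in> I \<Longrightarrow> nonempty_polytope (P i)"
  shows "support_fun (\<Sum>i\<in>I. P i) u = (\<Sum>i\<in>I. support_fun (P i) u)"
  using assms
  by (induction I rule: finite_induct)
    (auto simp: support_fun_plus nonempty_polytope_sum)

lemma nonempty_polytope_convex_hull:
  "finite A \<Longrightarrow> A \<noteq> {} \<Longrightarrow> nonempty_polytope (convex hull A)"
  by (auto simp: nonempty_polytope_def polytope_convex_hull)

lemma support_fun_convex_hull:
  assumes "finite A" "A \<noteq> {}"
  shows "support_fun (convex hull A) u = Max ((\<bullet>) u ` A)"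
  unfolding support_fun_def
proof (intro cSup_eq_maximum)
  have "Max ((\<bullet>) u ` A) \<in> (\<bullet>) u ` A"
    using assms by (intro Max_in) auto
  then show "Max ((\<bullet>) u ` A) \<in> (\<bullet>) u ` (convex hull A)"
    using hull_subset[of A convex] by blast
  have "convex hull A \<subseteq> {x. u \<bullet> x \<le> Max ((\<bullet>) u ` A)}"
    using assms by (intro hull_minimal) (auto simp: convex_halfspace_le)
  then show "y \<le> Max ((\<bullet>) u ` A)" if "y \<in> (\<bullet>) u ` (convex hull A)" for y
    using that by auto
qed


section \<open>Faces of the simplex are deformations\<close>

definition ind_vec :: "'v::finite set \<Rightarrow> real ^ 'v" where
  "ind_vec S = (\<chi> v. indicator S v)"

lemma ind_vec_nth [simp]: "ind_vec S $ v = indicator S v"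
  by (simp add: ind_vec_def)

lemma inner_ind_vec: "u \<bullet> ind_vec S = (\<Sum>v\<in>S. u $ v)"
proof -
  have "u \<bullet> ind_vec S = (\<Sum>v\<in>UNIV. if v \<in> S then u $ v else 0)"
    unfolding inner_vec_def by (intro sum.cong) (auto simp: indicator_def)
  also have "\<dots> = (\<Sum>v\<in>S. u $ v)"
    by (simp add: sum.If_cases)
  finally show ?thesis .
qed

definition hypersimplex :: "'v::finite set \<Rightarrow> nat \<Rightarrow> (real ^ 'v) set" where
  "hypersimplex K j = convex hull (ind_vec ` {A. A \<subseteq> K \<and> card A = j})"

lemma subsets_card_nonempty: "j \<le> card K \<Longrightarrow> {A. A \<subseteq> K \<and> card A = j} \<noteq> {}"
  using obtain_subset_with_card_n by blast

lemma nonempty_polytope_hypersimplex: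
  "j \<le> card K \<Longrightarrow> nonempty_polytope (hypersimplex K j)"
  unfolding hypersimplex_def using subsets_card_nonempty[of j K]
  by (intro nonempty_polytope_convex_hull) auto

lemma support_fun_hypersimplex:
  "j \<le> card K \<Longrightarrow>
    support_fun (hypersimplex K j) u = Max ((\<lambda>A. \<Sum>v\<in>A. u $ v) ` {A. A \<subseteq> K \<and> card A = j})"
  unfolding hypersimplex_def using subsets_card_nonempty[of j K]
  by (subst support_fun_convex_hull) (auto simp: image_image inner_ind_vec)

lemma simplex_face_eq_hypersimplex: "simplex_face K = hypersimplex K 1"
proof -
  have "{A. A \<subseteq> K \<and> card A = 1} = (\<lambda>u. {u}) ` K"
    by (auto simp: card_Suc_eq)
  moreover have "ind_vec {u} = axis u 1" for u :: 'a
    by (auto simp: vec_eq_iff axis_def indicator_def)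
  ultimately show ?thesis
    by (simp add: simplex_face_def hypersimplex_def image_image)
qed

lemma nonempty_polytope_simplex_face: "K \<noteq> {} \<Longrightarrow> nonempty_polytope (simplex_face K)"
  unfolding simplex_face_eq_hypersimplex
  by (rule nonempty_polytope_hypersimplex) (simp add: Suc_le_eq card_gt_0_iff)

lemma support_fun_simplex_face:
  assumes "K \<noteq> {}"
  shows "support_fun (simplex_face K) u = Max (($) u ` K)"
proof -
  have "(\<bullet>) u \<circ> (\<lambda>v. axis v 1) = ($) u"
    by (auto simp: fun_eq_iff inner_axis)
  then show ?thesis
    using assms by (simp add: simplex_face_def support_fun_convex_hull image_comp)
qed

text \<open>
  Ordering the values of \<open>f\<close> decreasingly, the \<open>i\<close>-th one is the maximum of \<open>card K - i\<close> pairs and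
  occurs in the maximal \<open>j\<close>-sums with \<open>j \<ge> i\<close>; the last sum on the left closes the gap of one.
\<close>

lemma sum_Max_pairs:
  fixes f :: "'v::finite \<Rightarrow> real"
  shows "(\<Sum>e | e \<subseteq> K \<and> card e = 2. Max (f ` e)) + (\<Sum>v\<in>K. f v)
    = (\<Sum>j=1..card K. Max (sum f ` {A. A \<subseteq> K \<and> card A = j}))"
  using finite[of K]
proof (induction K rule: finite_ranking_induct[where f = "\<lambda>v. - f v"])
  case empty
  have "{e. e \<subseteq> {} \<and> card e = 2} = ({} :: 'v set set)" by auto
  then show ?case by simp
next
  case (insert x S)
  show ?case
  proof (cases "x \<in> S")
    case True
    then show ?thesis using insert.IH by (simp add: insert_absorb)
  next
    case x: False
    have le: "f x \<le> f y" if "y \<in> S" for y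
      using insert.hyps(2)[OF that] by simp
    have pairs: "{e. e \<subseteq> insert x S \<and> card e = 2}
        = {e. e \<subseteq> S \<and> card e = 2} \<union> (\<lambda>y. {x, y}) ` S"
    proof (intro equalityI subsetI)
      fix e assume e: "e \<in> {e. e \<subseteq> insert x S \<and> card e = 2}"
      then obtain a b where "e = {a, b}" "a \<noteq> b"
        by (auto simp: card_2_iff)
      with e show "e \<in> {e. e \<subseteq> S \<and> card e = 2} \<union> (\<lambda>y. {x, y}) ` S"
        by auto
    qed (use x in \<open>auto simp: card_2_iff\<close>)
    have "(\<Sum>e | e \<subseteq> insert x S \<and> card e = 2. Max (f ` e))
        = (\<Sum>e | e \<subseteq> S \<and> card e = 2. Max (f ` e)) + (\<Sum>e\<in>(\<lambda>y. {x, y}) ` S. Max (f ` e))"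
      unfolding pairs using x by (intro sum.union_disjoint) auto
    also have "(\<Sum>e\<in>(\<lambda>y. {x, y}) ` S. Max (f ` e)) = (\<Sum>y\<in>S. Max (f ` {x, y}))"
      using x by (subst sum.reindex) (auto simp: inj_on_def doubleton_eq_iff)
    also have "\<dots> = (\<Sum>y\<in>S. f y)"
      using le by (intro sum.cong) auto
    finally have lhs: "(\<Sum>e | e \<subseteq> insert x S \<and> card e = 2. Max (f ` e))
        = (\<Sum>e | e \<subseteq> S \<and> card e = 2. Max (f ` e)) + (\<Sum>y\<in>S. f y)" .
    have max_eq: "Max (sum f ` {A. A \<subseteq> insert x S \<and> card A = j})
        = Max (sum f ` {A. A \<subseteq> S \<and> card A = j})" if j: "1 \<le> j" "j \<le> card S" for j
    proof (rule antisym)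
      show "Max (sum f ` {A. A \<subseteq> S \<and> card A = j})
          \<le> Max (sum f ` {A. A \<subseteq> insert x S \<and> card A = j})"
        using subsets_card_nonempty[OF j(2)] by (intro Max_mono image_mono) auto
      have "sum f A \<le> Max (sum f ` {A. A \<subseteq> S \<and> card A = j})"
        if A: "A \<subseteq> insert x S" "card A = j" for A
      proof (cases "x \<in> A")
        case False
        with A show ?thesis by (intro Max_ge) auto
      next
        case True
        have "\<not> S \<subseteq> A"
        proof
          assume "S \<subseteq> A"
          with True have "card (insert x S) \<le> card A"
            by (intro card_mono) auto
          with A j x show False by simp
        qed
        then obtain y where y: "y \<in> S" "y \<notin> A" by auto
        let ?B = "insert y (A - {x})"
        have "sum f A = f x + sum f (A - {x})"
          using True by (simp add: sum.remove)
        also have "\<dots> \<le> sum f ?B"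
          using y le by simp
        also have "?B \<subseteq> S" "card ?B = j"
          using A j y True by (auto simp: card_Diff_singleton)
        then have "sum f ?B \<le> Max (sum f ` {A. A \<subseteq> S \<and> card A = j})"
          by (intro Max_ge) auto
        finally show ?thesis .
      qed
      then show "Max (sum f ` {A. A \<subseteq> insert x S \<and> card A = j})
          \<le> Max (sum f ` {A. A \<subseteq> S \<and> card A = j})"
        using subsets_card_nonempty[of j "insert x S"] j x
        by (intro Max.boundedI) auto
    qed
    have "A = insert x S" if "A \<subseteq> insert x S" "card A = Suc (card S)" for A
      using that x by (intro card_subset_eq) auto
    then have "{A. A \<subseteq> insert x S \<and> card A = Suc (card S)} = {insert x S}"
      using x by auto
    then have "Max (sum f ` {A. A \<subseteq> insert x S \<and> card A = Suc (card S)}) = sum f (insert x S)"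
      by simp
    then have rhs: "(\<Sum>j=1..card (insert x S). Max (sum f ` {A. A \<subseteq> insert x S \<and> card A = j}))
        = (\<Sum>j=1..card S. Max (sum f ` {A. A \<subseteq> S \<and> card A = j})) + sum f (insert x S)"
      using x max_eq by simp
    show ?thesis
      unfolding lhs rhs using insert.IH x by simp
  qed
qed

lemma nonempty_polytope_graphical_zonotope:
  fixes E :: "'v::finite set set"
  assumes "simple_graph E"
  shows "nonempty_polytope (graphical_zonotope E)"
  unfolding graphical_zonotope_def using assms
  by (intro nonempty_polytope_sum nonempty_polytope_simplex_face) (auto simp: simple_graph_def)

lemma support_fun_graphical_zonotope:
  fixes E :: "'v::finite set set"
  assumes "simple_graph E"
  shows "support_fun (graphical_zonotope E) u = (\<Sum>e\<in>E. Max (($) u ` e))"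
proof -
  have "e \<noteq> {}" if "e \<in> E" for e
    using assms that by (auto simp: simple_graph_def)
  then show ?thesis
    unfolding graphical_zonotope_def
    by (subst support_fun_sum) (auto intro: nonempty_polytope_simplex_face
        simp: support_fun_simplex_face)
qed

lemma simplex_face_deformation:
  fixes E :: "'v::finite set set"
  assumes E: "simple_graph E" and K: "K \<in> nonempty_cliques E"
  shows "simplex_face K \<in> deformation_cone (graphical_zonotope E)"
proof -
  let ?pairs = "{e. e \<subseteq> K \<and> card e = 2}"
  have "K \<noteq> {}" and pairs: "?pairs \<subseteq> E"
    using K by (auto simp: nonempty_cliques_def induces_clique_def card_2_iff)
  then have card_K: "1 \<le> card K"
    by (simp add: Suc_le_eq card_gt_0_iff)
  note poly = nonempty_polytope_simplex_face[OF \<open>K \<noteq> {}\<close>]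
    nonempty_polytope_graphical_zonotope[OF E]
  define H where "H = (\<Sum>j=2..card K. hypersimplex K j)"
  define R where "R = graphical_zonotope (E - ?pairs)"
  define Q where "Q = H + R + {- ind_vec K}"
  have E': "simple_graph (E - ?pairs)"
    using E by (auto simp: simple_graph_def)
  have H: "nonempty_polytope H"
    unfolding H_def by (intro nonempty_polytope_sum nonempty_polytope_hypersimplex) auto
  have R: "nonempty_polytope R"
    unfolding R_def by (rule nonempty_polytope_graphical_zonotope[OF E'])
  have Q: "nonempty_polytope Q"
    unfolding Q_def by (intro nonempty_polytope_plus H R nonempty_polytope_sing)
  have "support_fun (simplex_face K + Q) u = support_fun (graphical_zonotope E) u" for u
  proof -
    have H_eq: "support_fun H u
        = (\<Sum>j=2..card K. Max (sum (($) u) ` {A. A \<subseteq> K \<and> card A = j}))"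
      unfolding H_def
      by (subst support_fun_sum) (auto intro: nonempty_polytope_hypersimplex
          simp: support_fun_hypersimplex)
    have "support_fun (simplex_face K) u + support_fun H u
        = (\<Sum>j=1..card K. Max (sum (($) u) ` {A. A \<subseteq> K \<and> card A = j}))"
      unfolding H_eq simplex_face_eq_hypersimplex support_fun_hypersimplex[OF card_K]
      using card_K by (subst sum.atLeast_Suc_atMost[of 1]) (simp_all add: numeral_2_eq_2)
    also have "\<dots> = (\<Sum>e\<in>?pairs. Max (($) u ` e)) + u \<bullet> ind_vec K"
      by (simp only: sum_Max_pairs[symmetric] inner_ind_vec)
    finally have "support_fun (simplex_face K) u + support_fun H u
      = (\<Sum>e\<in>?pairs. Max (($) u ` e)) + u \<bullet> ind_vec K" .
    moreover have "(\<Sum>e\<in>E. Max (($) u ` e))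
        = (\<Sum>e\<in>E - ?pairs. Max (($) u ` e)) + (\<Sum>e\<in>?pairs. Max (($) u ` e))"
      using pairs by (intro sum.subset_diff) auto
    ultimately show ?thesis
      using poly H R Q unfolding Q_def
      by (simp add: support_fun_plus nonempty_polytope_plus nonempty_polytope_sing
          support_fun_graphical_zonotope[OF E] support_fun_graphical_zonotope[OF E'] R_def)
  qed
  then have "simplex_face K + Q = (*\<^sub>R) 1 ` graphical_zonotope E"
    using poly Q support_fun_eq_iff[of "simplex_face K + Q" "graphical_zonotope E"]
    by (auto simp: fun_eq_iff nonempty_polytope_plus)
  then show ?thesis
    using poly Q unfolding deformation_cone_def by (intro CollectI conjI exI[of _ "1::real"] exI[of _ Q]) auto
qed

section \<open>Additivity of support functions of deformations\<close>

definition edge_comonotone :: "'v::finite set set \<Rightarrow> real ^ 'v \<Rightarrow> real ^ 'v \<Rightarrow> bool" where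
  "edge_comonotone E u w \<longleftrightarrow> (\<forall>a b. {a, b} \<in> E \<longrightarrow> 0 \<le> (u $ a - u $ b) * (w $ a - w $ b))"

lemma support_fun_zonotope_additive:
  fixes E :: "'v::finite set set"
  assumes E: "simple_graph E" and uw: "edge_comonotone E u w"
  shows "support_fun (graphical_zonotope E) (u + w)
    = support_fun (graphical_zonotope E) u + support_fun (graphical_zonotope E) w"
proof -
  have "Max (($) (u + w) ` e) = Max (($) u ` e) + Max (($) w ` e)" if e: "e \<in> E" for e
  proof -
    obtain a b where ab: "e = {a, b}"
      using E e by (auto simp: simple_graph_def card_2_iff)
    with e uw have "0 \<le> (u $ a - u $ b) * (w $ a - w $ b)"
      by (auto simp: edge_comonotone_def)
    with ab show ?thesis
      by (auto simp: zero_le_mult_iff max_def)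
  qed
  then show ?thesis
    by (simp add: support_fun_graphical_zonotope[OF E] sum.distrib)
qed

text \<open>Both summands of a multiple of the zonotope are subadditive, so equality for the sum forces
  equality for each.\<close>

lemma support_fun_deformation_additive:
  fixes E :: "'v::finite set set"
  assumes E: "simple_graph E" and P: "P \<in> deformation_cone (graphical_zonotope E)"
    and uw: "edge_comonotone E u w"
  shows "support_fun P (u + w) = support_fun P u + support_fun P w"
proof -
  obtain c Q where c: "0 \<le> c" and Q: "nonempty_polytope Q" and nP: "nonempty_polytope P"
    and PQ: "P + Q = (*\<^sub>R) c ` graphical_zonotope E"
    using P by (auto simp: deformation_cone_def)
  have sum: "support_fun P x + support_fun Q x = c * support_fun (graphical_zonotope E) x" for x
    using PQ c support_fun_plus[OF nP Q, of x]
    by (simp add: support_fun_scaleR nonempty_polytope_graphical_zonotope[OF E])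
  have "support_fun P (u + w) + support_fun Q (u + w)
      = (support_fun P u + support_fun Q u) + (support_fun P w + support_fun Q w)"
    by (simp add: sum support_fun_zonotope_additive[OF E uw] distrib_left)
  with support_fun_subadditive[OF nP, of u w] support_fun_subadditive[OF Q, of u w]
  show ?thesis by linarith
qed

lemma virtual_support_additive:
  fixes E :: "'v::finite set set"
  assumes E: "simple_graph E" and X: "X \<in> virtual_deformations (graphical_zonotope E)"
    and uw: "edge_comonotone E u w"
  shows "virtual_support X (u + w) = virtual_support X u + virtual_support X w"
  using X unfolding virtual_deformations_def
proof (rule span_induct)
  show "subspace {X. virtual_support X (u + w) = virtual_support X u + virtual_support X w}"
    by (auto simp: subspace_def virtual_support_zero virtual_support_plus virtual_support_scaleR
        algebra_simps)
next
  fix Y assume "Y \<in> virtual_of ` deformation_cone (graphical_zonotope E)"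
  then obtain P where P: "P \<in> deformation_cone (graphical_zonotope E)" and Y: "Y = virtual_of P"
    by blast
  moreover have "nonempty_polytope P"
    using P by (simp add: deformation_cone_def)
  ultimately show "virtual_support Y (u + w) = virtual_support Y u + virtual_support Y w"
    using support_fun_deformation_additive[OF E P uw] by (simp add: virtual_support_of)
qed

lemma virtual_polytope_cases:
  obtains P Q where "nonempty_polytope P" "nonempty_polytope Q" "X = virtual_diff P Q"
proof -
  obtain P Q where PQ: "rep_virtual_polytope X = (P, Q)"
    by (metis surj_pair)
  then have "virtual_rel (P, Q) (P, Q)"
    using Quotient_rep_reflp[OF Quotient_virtual_polytope, of X] by simp
  moreover have "X = virtual_diff P Q"
    using Quotient_abs_rep[OF Quotient_virtual_polytope, of X] PQ
    by (simp add: virtual_diff_def)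
  ultimately show thesis
    using that by (auto simp: virtual_rel_refl_iff)
qed

lemma virtual_support_pos_homogeneous:
  "0 \<le> c \<Longrightarrow> virtual_support X (c *\<^sub>R u) = c * virtual_support X u"
  by (cases X rule: virtual_polytope_cases)
    (simp add: virtual_support_diff support_fun_pos_homogeneous right_diff_distrib)

lemma virtual_support_at_zero [simp]: "virtual_support X 0 = 0"
  using virtual_support_pos_homogeneous[of 0 X 0] by simp


section \<open>Height vectors of virtual deformations\<close>

definition virtual_height :: "(real ^ 'v::finite) virtual_polytope \<Rightarrow> real ^ ('v set)" where
  "virtual_height X = (\<chi> S. virtual_support X (2 *\<^sub>R ind_vec S - ind_vec UNIV))"

lemma linear_virtual_height: "linear virtual_height"
  by (rule linearI)
    (simp_all add: vec_eq_iff virtual_height_def virtual_support_plus virtual_support_scaleR)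

lemma height_vector_eq_support_fun:
  "height_vector P $ S = support_fun P (2 *\<^sub>R ind_vec S - ind_vec UNIV)"
proof -
  have "(\<Sum>v\<in>S. x $ v) - (\<Sum>v\<in>- S. x $ v) = (2 *\<^sub>R ind_vec S - ind_vec UNIV) \<bullet> x" for x :: "real ^ 'a"
  proof -
    have "(\<Sum>v\<in>UNIV. x $ v) = (\<Sum>v\<in>S. x $ v) + (\<Sum>v\<in>- S. x $ v)"
      using sum.subset_diff[of S UNIV "($) x"] by (simp add: Compl_eq_Diff_UNIV)
    then show ?thesis
      by (simp add: inner_commute[of _ x] inner_diff_right inner_ind_vec)
  qed
  then show ?thesis
    by (simp add: height_vector_def support_fun_def)
qed

lemma virtual_height_diff:
  assumes "nonempty_polytope P" "nonempty_polytope Q"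
  shows "virtual_height (virtual_diff P Q) = height_vector P - height_vector Q"
  using assms
  by (simp add: vec_eq_iff virtual_height_def virtual_support_diff height_vector_eq_support_fun)

lemma virtual_support_minus_ones:
  fixes E :: "'v::finite set set"
  assumes "simple_graph E" "X \<in> virtual_deformations (graphical_zonotope E)"
  shows "virtual_support X (u - ind_vec UNIV)
    = virtual_support X u - virtual_support X (ind_vec UNIV)"
proof -
  have "virtual_support X ((u - ind_vec UNIV) + ind_vec UNIV)
      = virtual_support X (u - ind_vec UNIV) + virtual_support X (ind_vec UNIV)"
    by (rule virtual_support_additive[OF assms]) (simp add: edge_comonotone_def)
  then show ?thesis by simp
qed

lemma virtual_height_nth:
  fixes E :: "'v::finite set set"
  assumes "simple_graph E" "X \<in> virtual_deformations (graphical_zonotope E)"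
  shows "virtual_height X $ S
    = 2 * virtual_support X (ind_vec S) - virtual_support X (ind_vec UNIV)"
  by (simp add: virtual_height_def virtual_support_minus_ones[OF assms]
      virtual_support_pos_homogeneous)

lemma ind_vec_empty [simp]: "ind_vec {} = 0"
  by (simp add: vec_eq_iff)

lemma virtual_height_empty:
  fixes E :: "'v::finite set set"
  assumes "simple_graph E" "X \<in> virtual_deformations (graphical_zonotope E)"
  shows "virtual_height X $ {} = - virtual_height X $ UNIV"
  by (simp add: virtual_height_nth[OF assms])

lemma virtual_height_nonedge:
  fixes E :: "'v::finite set set"
  assumes "simple_graph E" "X \<in> virtual_deformations (graphical_zonotope E)"
    and ab: "a \<in> S" "b \<in> S" "a \<noteq> b" "{a, b} \<notin> E"
  shows "virtual_height X $ (S - {a}) + virtual_height X $ (S - {b})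
    = virtual_height X $ S + virtual_height X $ (S - {a, b})"
proof -
  have "edge_comonotone E (ind_vec (S - {a})) (ind_vec (S - {b}))"
    using ab by (auto simp: edge_comonotone_def indicator_def insert_commute)
  then have "virtual_support X (ind_vec (S - {a}) + ind_vec (S - {b}))
      = virtual_support X (ind_vec (S - {a})) + virtual_support X (ind_vec (S - {b}))"
    by (rule virtual_support_additive[OF assms(1,2)])
  moreover have "edge_comonotone E (ind_vec S) (ind_vec (S - {a, b}))"
    by (auto simp: edge_comonotone_def indicator_def)
  then have "virtual_support X (ind_vec S + ind_vec (S - {a, b}))
      = virtual_support X (ind_vec S) + virtual_support X (ind_vec (S - {a, b}))"
    by (rule virtual_support_additive[OF assms(1,2)])
  moreover have "ind_vec (S - {a}) + ind_vec (S - {b}) = ind_vec S + ind_vec (S - {a, b})"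
    using ab by (auto simp: vec_eq_iff indicator_def)
  ultimately show ?thesis
    by (simp add: virtual_height_nth[OF assms(1,2)])
qed

text \<open>A nonnegative vector is a combination, with positive coefficients, of indicator vectors of a
  chain of sets, which are pairwise comonotone.\<close>

lemma virtual_height_eq_0_imp:
  fixes E :: "'v::finite set set"
  assumes E: "simple_graph E" and X: "X \<in> virtual_deformations (graphical_zonotope E)"
    and 0: "virtual_height X = 0"
  shows "X = 0"
proof (rule virtual_eqI)
  have "virtual_support X (ind_vec UNIV) = 0"
    using virtual_height_nth[OF E X, of UNIV] 0 by simp
  then have ind: "virtual_support X (ind_vec S) = 0" for S
    using virtual_height_nth[OF E X, of S] 0 by simp
  have nonneg: "virtual_support X u = 0" if "\<And>v. 0 \<le> u $ v" for u :: "real ^ 'v"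
    using that
  proof (induction "card {v. u $ v \<noteq> 0}" arbitrary: u rule: less_induct)
    case less
    let ?T = "{v. u $ v \<noteq> 0}"
    show ?case
    proof (cases "?T = {}")
      case True
      then have "u = 0" by (simp add: vec_eq_iff)
      then show ?thesis by simp
    next
      case False
      define m where "m = Min (($) u ` ?T)"
      define w where "w = u - m *\<^sub>R ind_vec ?T"
      have "m \<in> ($) u ` ?T"
        unfolding m_def using False by (intro Min_in) auto
      then obtain t where t: "u $ t \<noteq> 0" "m = u $ t" by auto
      with less.prems[of t] have m: "0 < m" by simp
      have m_le: "m \<le> u $ v" if "u $ v \<noteq> 0" for v
        unfolding m_def using that by (intro Min_le) auto
      have w_out: "w $ v = 0" if "u $ v = 0" for v
        using that by (simp add: w_def)
      have w_nonneg: "0 \<le> w $ v" for v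
        using m_le[of v] w_out[of v] by (cases "u $ v = 0") (auto simp: w_def)
      have "w $ t = 0"
        using t by (simp add: w_def)
      then have "{v. w $ v \<noteq> 0} \<subset> ?T"
        using w_out t by blast
      then have "virtual_support X w = 0"
        using w_nonneg by (intro less.hyps psubset_card_mono) auto
      moreover have "edge_comonotone E (m *\<^sub>R ind_vec ?T) w"
        using m w_nonneg w_out
        by (auto simp: edge_comonotone_def indicator_def mult_nonneg_nonpos)
      then have "virtual_support X (m *\<^sub>R ind_vec ?T + w)
          = virtual_support X (m *\<^sub>R ind_vec ?T) + virtual_support X w"
        by (rule virtual_support_additive[OF E X])
      ultimately show ?thesis
        using ind[of ?T] m by (simp add: virtual_support_pos_homogeneous w_def)
    qed
  qed
  show "virtual_support X u = virtual_support 0 u" for u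
  proof -
    define s where "s = (\<Sum>v\<in>UNIV. \<bar>u $ v\<bar>)"
    have s: "\<bar>u $ v\<bar> \<le> s" for v
      unfolding s_def by (rule member_le_sum) auto
    have "0 \<le> s"
      by (simp add: s_def sum_nonneg)
    have "virtual_support X (u + s *\<^sub>R ind_vec UNIV)
        = virtual_support X u + virtual_support X (s *\<^sub>R ind_vec UNIV)"
      by (rule virtual_support_additive[OF E X]) (simp add: edge_comonotone_def)
    moreover have "virtual_support X (u + s *\<^sub>R ind_vec UNIV) = 0"
    proof (rule nonneg)
      show "0 \<le> (u + s *\<^sub>R ind_vec UNIV) $ v" for v
        using s[of v] by simp
    qed
    ultimately show ?thesis
      using ind[of UNIV] \<open>0 \<le> s\<close>
      by (simp add: virtual_support_pos_homogeneous virtual_support_zero)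
  qed
qed

lemma deformation_cone_plus:
  assumes R: "nonempty_polytope R" and "P \<in> deformation_cone R" "P' \<in> deformation_cone R"
  shows "P + P' \<in> deformation_cone R"
proof -
  obtain c Q where P: "nonempty_polytope P" "0 \<le> c" "nonempty_polytope Q" "P + Q = (*\<^sub>R) c ` R"
    using assms(2) by (auto simp: deformation_cone_def)
  obtain c' Q' where P': "nonempty_polytope P'" "0 \<le> c'" "nonempty_polytope Q'"
      "P' + Q' = (*\<^sub>R) c' ` R"
    using assms(3) by (auto simp: deformation_cone_def)
  have "support_fun (P + P' + (Q + Q')) u = support_fun ((*\<^sub>R) (c + c') ` R) u" for u
  proof -
    have "support_fun (P + P' + (Q + Q')) u = support_fun (P + Q) u + support_fun (P' + Q') u"
      using P(1,3) P'(1,3) by (simp add: support_fun_plus nonempty_polytope_plus)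
    also have "\<dots> = support_fun ((*\<^sub>R) (c + c') ` R) u"
      unfolding P(4) P'(4) using P(2) P'(2) R by (simp add: support_fun_scaleR distrib_right)
    finally show ?thesis .
  qed
  then have "P + P' + (Q + Q') = (*\<^sub>R) (c + c') ` R"
    using P(1,3) P'(1,3) R
    by (subst support_fun_eq_iff) (auto intro: nonempty_polytope_plus nonempty_polytope_scaleR)
  moreover have "nonempty_polytope (P + P')" "nonempty_polytope (Q + Q')"
    using P P' by (simp_all add: nonempty_polytope_plus)
  ultimately show ?thesis
    using P(2) P'(2) unfolding deformation_cone_def
    by (intro CollectI conjI exI[of _ "c + c'"] exI[of _ "Q + Q'"]) auto
qed

lemma deformation_cone_scaleR:
  assumes "P \<in> deformation_cone R" "0 \<le> d"
  shows "(*\<^sub>R) d ` P \<in> deformation_cone R"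
proof -
  obtain c Q where P: "nonempty_polytope P" "0 \<le> c" "nonempty_polytope Q" "P + Q = (*\<^sub>R) c ` R"
    using assms(1) by (auto simp: deformation_cone_def)
  have "(*\<^sub>R) d ` P + (*\<^sub>R) d ` Q = (*\<^sub>R) d ` (P + Q)"
    by (force simp: set_plus_def scaleR_add_right image_iff)
  also have "\<dots> = (*\<^sub>R) (d * c) ` R"
    by (simp add: P(4) image_image)
  finally show ?thesis
    using P assms(2) unfolding deformation_cone_def
    by (intro CollectI conjI exI[of _ "d * c"] exI[of _ "(*\<^sub>R) d ` Q"])
      (auto intro: nonempty_polytope_scaleR)
qed

lemma zero_in_deformation_cone:
  "nonempty_polytope R \<Longrightarrow> {0::'a::euclidean_space} \<in> deformation_cone R"
  using nonempty_polytope_sing[of "0::'a"] unfolding deformation_cone_def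
  by (intro CollectI conjI exI[of _ 0] exI[of _ "{0}"])
    (auto simp: nonempty_polytope_def set_plus_def)

lemma virtual_deformations_eq_diffs:
  assumes R: "nonempty_polytope R"
  shows "virtual_deformations R
    = {virtual_diff P Q | P Q. P \<in> deformation_cone R \<and> Q \<in> deformation_cone R}"
    (is "_ = ?D")
proof
  have poly: "nonempty_polytope P" if "P \<in> deformation_cone R" for P
    using that by (simp add: deformation_cone_def)
  show "?D \<subseteq> virtual_deformations R"
    using poly
    by (auto simp: virtual_deformations_def virtual_diff_eq_minus
        intro!: span_diff[OF span_base span_base])
  show "virtual_deformations R \<subseteq> ?D"
    unfolding virtual_deformations_def
  proof (rule span_minimal)
    show "virtual_of ` deformation_cone R \<subseteq> ?D"
      using zero_in_deformation_cone[OF R] by blast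
    show "subspace ?D"
    proof (rule subspaceI)
      have "0 = virtual_of {0::'a}"
        by (rule virtual_eqI) (simp add: virtual_support_zero virtual_support_diff
            nonempty_polytope_sing)
      then show "0 \<in> ?D"
        using zero_in_deformation_cone[OF R] by blast
    next
      fix x y assume "x \<in> ?D" "y \<in> ?D"
      then obtain P Q P' Q' where x: "x = virtual_diff P Q" "P \<in> deformation_cone R"
          "Q \<in> deformation_cone R"
        and y: "y = virtual_diff P' Q'" "P' \<in> deformation_cone R" "Q' \<in> deformation_cone R"
        by blast
      have "x + y = virtual_diff (P + P') (Q + Q')"
        unfolding x(1) y(1) using x(2,3) y(2,3)
        by (intro virtual_eqI) (simp add: poly virtual_support_plus virtual_support_diff
            nonempty_polytope_plus support_fun_plus)
      then show "x + y \<in> ?D"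
        using x(2,3) y(2,3) deformation_cone_plus[OF R] by blast
    next
      fix c x assume "x \<in> ?D"
      then obtain P Q where x: "x = virtual_diff P Q" "P \<in> deformation_cone R"
          "Q \<in> deformation_cone R"
        by blast
      show "c *\<^sub>R x \<in> ?D"
      proof (cases "0 \<le> c")
        case True
        then have "c *\<^sub>R x = virtual_diff ((*\<^sub>R) c ` P) ((*\<^sub>R) c ` Q)"
          unfolding x(1) using x(2,3)
          by (intro virtual_eqI) (simp add: poly virtual_support_scaleR virtual_support_diff
              nonempty_polytope_scaleR support_fun_scaleR right_diff_distrib)
        then show ?thesis
          using x(2,3) True deformation_cone_scaleR by blast
      next
        case False
        then have c: "0 \<le> - c" by simp
        have "c *\<^sub>R x = virtual_diff ((*\<^sub>R) (- c) ` Q) ((*\<^sub>R) (- c) ` P)"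
          unfolding x(1) using x(2,3) c
          by (intro virtual_eqI) (simp add: poly virtual_support_scaleR virtual_support_diff
              nonempty_polytope_scaleR support_fun_scaleR right_diff_distrib
              del: scaleR_minus_left)
        then show ?thesis
          using x(2,3) c deformation_cone_scaleR by blast
      qed
    qed
  qed
qed

lemma represents_iff:
  fixes E :: "'v::finite set set"
  assumes "simple_graph E"
  shows "represents E h X
    \<longleftrightarrow> X \<in> virtual_deformations (graphical_zonotope E) \<and> h = virtual_height X"
proof -
  have "virtual_height (virtual_diff P Q) = height_vector P - height_vector Q"
    if "P \<in> deformation_cone (graphical_zonotope E)" "Q \<in> deformation_cone (graphical_zonotope E)"
    for P Q
    using that by (simp add: deformation_cone_def virtual_height_diff)
  then show ?thesis
    unfolding represents_def
      virtual_deformations_eq_diffs[OF nonempty_polytope_graphical_zonotope[OF assms]]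
    by auto
qed


section \<open>Linear independence and dimension count\<close>

lemma inj_on_independent_if_scalars_zero:
  fixes f :: "'i \<Rightarrow> 'a::real_vector"
  assumes fin: "finite I"
    and 0: "\<And>c i. (\<Sum>i\<in>I. c i *\<^sub>R f i) = 0 \<Longrightarrow> i \<in> I \<Longrightarrow> c i = 0"
  shows "inj_on f I" and "independent (f ` I)"
proof -
  show inj: "inj_on f I"
  proof (rule inj_onI, rule ccontr)
    fix i j assume ij: "i \<in> I" "j \<in> I" "f i = f j" "i \<noteq> j"
    let ?c = "\<lambda>k. of_bool (k = i) - of_bool (k = j) :: real"
    have "(\<Sum>k\<in>I. ?c k *\<^sub>R f k)
        = (\<Sum>k\<in>I. if k = i then f k else 0) - (\<Sum>k\<in>I. if k = j then f k else 0)"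
      by (subst sum_subtractf[symmetric]) (auto intro!: sum.cong)
    also have "\<dots> = 0"
      using ij fin by simp
    finally show False
      using 0[of ?c i] ij by simp
  qed
  show "independent (f ` I)"
  proof (rule independent_if_scalars_zero)
    fix c x assume c: "(\<Sum>x\<in>f ` I. c x *\<^sub>R x) = 0" and x: "x \<in> f ` I"
    have "(\<Sum>i\<in>I. c (f i) *\<^sub>R f i) = 0"
      using c by (simp add: sum.reindex[OF inj])
    then show "c x = 0"
      using 0[of "c \<circ> f"] x by auto
  qed (use fin in simp)
qed

lemma virtual_height_simplex_face:
  fixes K :: "'v::finite set"
  assumes "K \<noteq> {}"
  shows "virtual_height (virtual_of (simplex_face K)) $ S = (if K \<inter> S = {} then -1 else 1)"
proof -
  have "virtual_height (virtual_of (simplex_face K)) $ S = Max ((\<lambda>v. 2 * indicat_real S v - 1) ` K)"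
    using assms by (simp add: virtual_height_def virtual_support_of
        nonempty_polytope_simplex_face support_fun_simplex_face)
  also have "\<dots> = (if K \<inter> S = {} then -1 else 1)"
    using assms by (intro Max_eqI) (auto simp: indicator_def image_iff)
  finally show ?thesis .
qed

text \<open>Pairing with the height at the complement of \<open>T\<close> gives the sum of the coefficients of all
  subsets of \<open>T\<close>.\<close>

lemma simplex_face_coeffs_zero:
  fixes \<K> :: "'v::finite set set"
  assumes ne: "{} \<notin> \<K>"
    and 0: "(\<Sum>K\<in>\<K>. c K *\<^sub>R virtual_height (virtual_of (simplex_face K))) = 0"
    and "K \<in> \<K>"
  shows "c K = 0"
proof -
  have h: "(\<Sum>K\<in>\<K>. c K * (if K \<inter> S = {} then -1 else 1)) = 0" for S
  proof -
    have "(\<Sum>K\<in>\<K>. c K * (if K \<inter> S = {} then -1 else 1))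
        = (\<Sum>K\<in>\<K>. c K *\<^sub>R virtual_height (virtual_of (simplex_face K))) $ S"
      unfolding sum_component
    proof (intro sum.cong refl)
      fix K assume "K \<in> \<K>"
      then have "K \<noteq> {}" using ne by auto
      then show "c K * (if K \<inter> S = {} then -1 else 1)
          = (c K *\<^sub>R virtual_height (virtual_of (simplex_face K))) $ S"
        by (simp add: virtual_height_simplex_face)
    qed
    then show ?thesis by (simp add: 0)
  qed
  have below: "(\<Sum>K\<in>\<K>. if K \<subseteq> T then c K else 0) = 0" for T
  proof -
    have "(\<Sum>K\<in>\<K>. if K \<subseteq> T then c K else 0)
        = (\<Sum>K\<in>\<K>. - (c K * (if K \<inter> {} = {} then -1 else 1) / 2)
            - c K * (if K \<inter> - T = {} then -1 else 1) / 2)"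
      by (intro sum.cong) auto
    also have "\<dots> = 0"
      unfolding sum_subtractf sum_negf sum_divide_distrib[symmetric] h by simp
    finally show ?thesis .
  qed
  show ?thesis
    using \<open>K \<in> \<K>\<close>
  proof (induction "card K" arbitrary: K rule: less_induct)
    case less
    have "(\<Sum>L\<in>\<K>. if L \<subseteq> K then c L else 0) = (\<Sum>L\<in>\<K>. if L = K then c K else 0)"
      using less.hyps by (intro sum.cong) (auto simp: psubset_card_mono psubset_eq)
    with below[of K] less.prems show ?case by simp
  qed
qed

text \<open>The all-ones vector is orthogonal to every equation of a nonclique; the latter are
  triangular with respect to inclusion.\<close>

lemma equation_coeffs_zero:
  fixes E :: "'v::finite set set"
  assumes ch: "nonedge_choice E us vs"
    and 0: "(\<Sum>i\<in>insert None (Some ` nonclique_sets E). c i *\<^sub>R equation_coeffs us vs i) = 0"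
    and i: "i \<in> insert None (Some ` nonclique_sets E)"
  shows "c i = 0"
proof -
  let ?N = "nonclique_sets E"
  have split: "(\<Sum>i\<in>insert None (Some ` ?N). g i) = g None + (\<Sum>S\<in>?N. g (Some S))"
    for g :: "'v set option \<Rightarrow> 'b::comm_monoid_add"
    by (subst sum.insert) (auto simp: sum.reindex)
  have None: "c None = 0"
  proof -
    let ?one = "\<chi> S. 1 :: real ^ 'v set"
    have "0 = (\<Sum>i\<in>insert None (Some ` ?N). c i *\<^sub>R equation_coeffs us vs i) \<bullet> ?one"
      by (simp only: 0) simp
    also have "\<dots> = c None * 2"
      unfolding split
      by (simp add: inner_add_left inner_diff_left inner_sum_left inner_axis')
    finally show ?thesis by simp
  qed
  have Some: "c (Some S) = 0" if "S \<in> ?N" for S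
    using that
  proof (induction "card (- S)" arbitrary: S rule: less_induct)
    case less
    have "0 = (\<Sum>i\<in>insert None (Some ` ?N). c i *\<^sub>R equation_coeffs us vs i) $ S"
      by (simp only: 0) simp
    also have "\<dots> = (\<Sum>T\<in>?N. c (Some T) * equation_coeffs us vs (Some T) $ S)"
      unfolding split by (simp add: None del: equation_coeffs.simps)
    also have "\<dots> = (\<Sum>T\<in>?N. if T = S then - c (Some S) else 0)"
    proof (intro sum.cong refl)
      fix T assume T: "T \<in> ?N"
      then have uv: "us T \<in> T" "vs T \<in> T"
        using ch by (auto simp: nonedge_choice_def)
      show "c (Some T) * equation_coeffs us vs (Some T) $ S = (if T = S then - c (Some S) else 0)"
      proof (cases "S \<subset> T")
        case True
        then have "c (Some T) = 0"
          using T by (intro less.hyps psubset_card_mono) auto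
        with True show ?thesis by auto
      next
        case False
        with uv show ?thesis by (auto simp: axis_def)
      qed
    qed
    finally show ?case
      using less.prems by simp
  qed
  show ?thesis
    using i None Some by auto
qed

lemma equation_coeffs_independent:
  fixes E :: "'v::finite set set"
  assumes "nonedge_choice E us vs"
  shows "inj_on (equation_coeffs us vs) (insert None (Some ` nonclique_sets E))"
    and "independent (equation_coeffs us vs ` insert None (Some ` nonclique_sets E))"
  by (rule inj_on_independent_if_scalars_zero[OF finite], erule (1) equation_coeffs_zero[OF assms])+

lemma card_nonclique_sets:
  fixes E :: "'v::finite set set"
  shows "card (nonclique_sets E) + card (nonempty_cliques E) + 1 = CARD('v set)"
proof -
  have clique: "induces_clique E S" if "\<not> 2 \<le> card S" for S
  proof -
    have "u = v" if "u \<in> S" "v \<in> S" for u v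
      using \<open>\<not> 2 \<le> card S\<close> that card_le_Suc0_iff_eq[of S] by auto
    then show ?thesis by (auto simp: induces_clique_def)
  qed
  have "(UNIV :: 'v set set) = insert {} (nonclique_sets E \<union> nonempty_cliques E)"
    using clique by (auto simp: nonclique_sets_def nonempty_cliques_def)
  moreover have "card (insert {} (nonclique_sets E \<union> nonempty_cliques E))
      = Suc (card (nonclique_sets E \<union> nonempty_cliques E))"
    by (rule card_insert_disjoint) (auto simp: nonclique_sets_def nonempty_cliques_def)
  moreover have "card (nonclique_sets E \<union> nonempty_cliques E)
      = card (nonclique_sets E) + card (nonempty_cliques E)"
    by (rule card_Un_disjoint) (auto simp: nonclique_sets_def nonempty_cliques_def)
  ultimately show ?thesis by simp
qed

definition height_equations ::
    "'v::finite set set \<Rightarrow> ('v set \<Rightarrow> 'v) \<Rightarrow> ('v set \<Rightarrow> 'v) \<Rightarrow> (real ^ ('v set)) set" where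
  "height_equations E us vs = {h. h $ {} = - (h $ UNIV)
     \<and> (\<forall>S\<in>nonclique_sets E.
          h $ (S - {us S}) + h $ (S - {vs S}) = h $ S + h $ (S - {us S, vs S}))}"

lemma height_equations_eq_orthogonal:
  fixes E :: "'v::finite set set"
  shows "height_equations E us vs = {h. \<forall>x\<in>span (equation_coeffs us vs `
    insert None (Some ` nonclique_sets E)). orthogonal x h}" (is "_ = {h. \<forall>x\<in>span ?C. _ x h}")
proof -
  have "(\<forall>x\<in>span ?C. orthogonal x h) \<longleftrightarrow> (\<forall>x\<in>?C. orthogonal x h)" for h
  proof
    assume "\<forall>x\<in>?C. orthogonal x h"
    then have "?C \<subseteq> {x. orthogonal x h}" by blast
    then have "span ?C \<subseteq> {x. orthogonal x h}"
      by (rule span_minimal)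
        (auto simp: subspace_def orthogonal_def inner_add_left)
    then show "\<forall>x\<in>span ?C. orthogonal x h" by blast
  qed (blast intro: span_base)
  moreover have "h \<in> height_equations E us vs \<longleftrightarrow> (\<forall>x\<in>?C. orthogonal x h)" for h
    by (simp add: height_equations_def orthogonal_def equation_coeffs_None_iff
        equation_coeffs_Some_iff del: equation_coeffs.simps)
  ultimately show ?thesis by auto
qed

lemma dim_height_equations:
  fixes E :: "'v::finite set set"
  assumes "nonedge_choice E us vs"
  shows "dim (height_equations E us vs) = card (nonempty_cliques E)"
proof -
  let ?I = "insert None (Some ` nonclique_sets E)"
  let ?C = "equation_coeffs us vs ` ?I"
  note indep = equation_coeffs_independent[OF assms]
  have "dim (height_equations E us vs) + dim (span ?C) = dim (UNIV :: (real ^ 'v set) set)"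
    unfolding height_equations_eq_orthogonal
    using dim_subspace_orthogonal_to_vectors[of "span ?C" UNIV] by simp
  moreover have "dim (span ?C) = card ?C"
    using indep(2) by (rule dim_span_eq_card_independent)
  moreover have "card ?C = card (nonclique_sets E) + 1"
    using indep(1) by (simp add: card_image del: image_insert)
  moreover have "dim (UNIV :: (real ^ 'v set) set) = CARD('v set)"
    by simp
  ultimately show ?thesis
    using card_nonclique_sets[of E] by linarith
qed

lemma virtual_height_in_height_equations:
  fixes E :: "'v::finite set set"
  assumes "simple_graph E" "nonedge_choice E us vs"
    and "X \<in> virtual_deformations (graphical_zonotope E)"
  shows "virtual_height X \<in> height_equations E us vs"
  using assms(2) virtual_height_empty[OF assms(1,3)] virtual_height_nonedge[OF assms(1,3)]
  by (auto simp: height_equations_def nonedge_choice_def)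

lemma inj_on_virtual_height:
  fixes E :: "'v::finite set set"
  assumes "simple_graph E"
  shows "inj_on virtual_height (virtual_deformations (graphical_zonotope E))"
proof (rule inj_onI)
  fix X Y assume XY: "X \<in> virtual_deformations (graphical_zonotope E)"
    "Y \<in> virtual_deformations (graphical_zonotope E)" "virtual_height X = virtual_height Y"
  then have "X - Y \<in> virtual_deformations (graphical_zonotope E)"
    by (simp add: virtual_deformations_def span_diff)
  moreover have "virtual_height (X - Y) = 0"
    using XY(3) by (simp add: linear_diff[OF linear_virtual_height])
  ultimately show "X = Y"
    using virtual_height_eq_0_imp[OF assms] by fastforce
qed

lemma span_simplex_faces:
  fixes E :: "'v::finite set set"
  assumes E: "simple_graph E" and ch: "nonedge_choice E us vs"
  defines "B \<equiv> (\<lambda>K. virtual_of (simplex_face K)) ` nonempty_cliques E"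
  shows "span B = virtual_deformations (graphical_zonotope E)"
    and "virtual_height ` virtual_deformations (graphical_zonotope E) = height_equations E us vs"
proof -
  let ?VD = "virtual_deformations (graphical_zonotope E)"
  let ?h = "\<lambda>K. virtual_height (virtual_of (simplex_face K)) :: real ^ 'v set"
  have VD: "span B \<subseteq> ?VD"
    unfolding virtual_deformations_def B_def
    by (intro span_mono) (auto simp: simplex_face_deformation[OF E])
  have h_VD: "virtual_height ` ?VD \<subseteq> height_equations E us vs"
    using virtual_height_in_height_equations[OF E ch] by blast
  have hB: "virtual_height ` B = ?h ` nonempty_cliques E"
    by (simp add: B_def image_image)
  have indep: "inj_on ?h (nonempty_cliques E)" "independent (?h ` nonempty_cliques E)"
    by (rule inj_on_independent_if_scalars_zero[OF finite],
        erule (1) simplex_face_coeffs_zero[rotated], simp add: nonempty_cliques_def)+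
  have "height_equations E us vs \<subseteq> span (virtual_height ` B)"
  proof (rule card_ge_dim_independent)
    show "virtual_height ` B \<subseteq> height_equations E us vs"
      using h_VD VD span_superset[of B] by blast
    show "independent (virtual_height ` B)"
      unfolding hB by (rule indep(2))
    show "dim (height_equations E us vs) \<le> card (virtual_height ` B)"
      unfolding hB by (simp add: card_image[OF indep(1)] dim_height_equations[OF ch])
  qed
  then have sub: "height_equations E us vs \<subseteq> virtual_height ` span B"
    by (simp add: linear_span_image[OF linear_virtual_height])
  with VD h_VD show "virtual_height ` ?VD = height_equations E us vs"
    by blast
  show "span B = ?VD"
  proof
    show "?VD \<subseteq> span B"
    proof
      fix X assume X: "X \<in> ?VD"
      then obtain Y where Y: "Y \<in> span B" "virtual_height X = virtual_height Y"
        using h_VD sub by blast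
      with X VD have "X = Y"
        by (intro inj_onD[OF inj_on_virtual_height[OF E]]) auto
      with Y show "X \<in> span B" by simp
    qed
  qed (rule VD)
qed

lemma ex_nonedge_choice: "\<exists>us vs. nonedge_choice E us vs"
proof -
  have "\<forall>S. \<exists>u v. S \<in> nonclique_sets E \<longrightarrow> u \<in> S \<and> v \<in> S \<and> u \<noteq> v \<and> {u, v} \<notin> E"
    by (auto simp: nonclique_sets_def induces_clique_def)
  then show ?thesis
    unfolding nonedge_choice_def by metis
qed

theorem theorem2p5:
  fixes E :: "'v::finite set set"
  assumes "simple_graph E"
  shows "dim (virtual_deformations (graphical_zonotope E)) = card (nonempty_cliques E)
    \<and> (inj_on (\<lambda>K. virtual_of (simplex_face K)) (nonempty_cliques E)
       \<and> independent ((\<lambda>K. virtual_of (simplex_face K)) ` nonempty_cliques E)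
       \<and> span ((\<lambda>K. virtual_of (simplex_face K)) ` nonempty_cliques E)
           = virtual_deformations (graphical_zonotope E))
    \<and> (\<forall>us vs. nonedge_choice E us vs \<longrightarrow>
         (let sol = {h :: real ^ ('v set).
                h $ {} = - (h $ UNIV)
                \<and> (\<forall>S\<in>nonclique_sets E.
                     h $ (S - {us S}) + h $ (S - {vs S}) = h $ S + h $ (S - {us S, vs S}))};
              eqs = insert None (Some ` nonclique_sets E)
          in (\<forall>h\<in>sol. \<exists>!X. represents E h X)
             \<and> virtual_deformations (graphical_zonotope E) = virtual_D E ` sol
             \<and> inj_on (equation_coeffs us vs) eqs
             \<and> independent (equation_coeffs us vs ` eqs)))"
proof -
  let ?VD = "virtual_deformations (graphical_zonotope E)"
  let ?f = "\<lambda>K. virtual_of (simplex_face K) :: (real ^ 'v) virtual_polytope"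
  have scalars: "c K = 0"
    if 0: "(\<Sum>K\<in>nonempty_cliques E. c K *\<^sub>R ?f K) = 0" and K: "K \<in> nonempty_cliques E" for c K
  proof (rule simplex_face_coeffs_zero)
    have "(\<Sum>K\<in>nonempty_cliques E. c K *\<^sub>R virtual_height (?f K))
        = virtual_height (\<Sum>K\<in>nonempty_cliques E. c K *\<^sub>R ?f K)"
      by (simp add: linear_sum[OF linear_virtual_height] linear_cmul[OF linear_virtual_height])
    also have "\<dots> = 0"
      by (simp add: 0 linear_0[OF linear_virtual_height])
    finally show "(\<Sum>K\<in>nonempty_cliques E. c K *\<^sub>R virtual_height (?f K)) = 0" .
  qed (use K in \<open>auto simp: nonempty_cliques_def\<close>)
  have inj: "inj_on ?f (nonempty_cliques E)"
    and indep: "independent (?f ` nonempty_cliques E)"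
    by (rule inj_on_independent_if_scalars_zero[OF finite], erule (1) scalars)+
  have span: "span (?f ` nonempty_cliques E) = ?VD"
    using ex_nonedge_choice[of E] span_simplex_faces(1)[OF assms] by metis
  have dim: "dim ?VD = card (nonempty_cliques E)"
    unfolding span[symmetric] dim_span_eq_card_independent[OF indep] by (rule card_image[OF inj])
  have "(\<forall>h\<in>height_equations E us vs. \<exists>!X. represents E h X)
      \<and> ?VD = virtual_D E ` height_equations E us vs
      \<and> inj_on (equation_coeffs us vs) (insert None (Some ` nonclique_sets E))
      \<and> independent (equation_coeffs us vs ` insert None (Some ` nonclique_sets E))"
    if ch: "nonedge_choice E us vs" for us vs
  proof (intro conjI)
    have unique: "X = Y" if "represents E h X" "represents E h Y" for h X Y
      using that inj_onD[OF inj_on_virtual_height[OF assms], of X Y]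
      by (simp add: represents_iff[OF assms])
    have image: "virtual_height ` ?VD = height_equations E us vs"
      by (rule span_simplex_faces(2)[OF assms ch])
    show "\<forall>h\<in>height_equations E us vs. \<exists>!X. represents E h X"
    proof
      fix h assume "h \<in> height_equations E us vs"
      then obtain X where "represents E h X"
        unfolding image[symmetric] represents_iff[OF assms] by blast
      then show "\<exists>!X. represents E h X"
        using unique by blast
    qed
    have "virtual_D E (virtual_height X) = X" if "X \<in> ?VD" for X
    proof -
      have "represents E (virtual_height X) X"
        using that by (simp add: represents_iff[OF assms])
      then show ?thesis
        unfolding virtual_D_def using unique by blast
    qed
    then show "?VD = virtual_D E ` height_equations E us vs"
      unfolding image[symmetric] by (force simp: image_image)
    show "inj_on (equation_coeffs us vs) (insert None (Some ` nonclique_sets E))"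
      and "independent (equation_coeffs us vs ` insert None (Some ` nonclique_sets E))"
      by (rule equation_coeffs_independent[OF ch])+
  qed
  then have equations: "\<forall>us vs. nonedge_choice E us vs \<longrightarrow>
      (\<forall>h\<in>height_equations E us vs. \<exists>!X. represents E h X)
      \<and> ?VD = virtual_D E ` height_equations E us vs
      \<and> inj_on (equation_coeffs us vs) (insert None (Some ` nonclique_sets E))
      \<and> independent (equation_coeffs us vs ` insert None (Some ` nonclique_sets E))"
    by blast
  show ?thesis
    unfolding Let_def height_equations_def[symmetric]
    by (intro conjI dim inj indep span equations)
qed

end
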